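(* Let $X=\ell^2$ and $Y=\ell^\infty$ be the spaces of square-summable, respectively bounded, complex-valued sequences indexed by $\mathbb N$, with their usual norms. Let $(z_k)_{k\in\mathbb N}$ be a countable dense subset of the unit sphere of $\ell^2$ and let $C:\ell^2\to\ell^\infty$, $Cx:=(\langle x,z_k\rangle_{\ell^2})_{k\in\mathbb N}$ (a linear isometry). Consider the system $$\dot x(t)=0,\quad y(t)=Cx(t),$$ i.e. $A=0$ and $T(t)=\operatorname{Id}$ for $t\ge0$. Then: (i) The system admits a coercive eOSS Lyapunov function in dissipation form with linear Lyapunov gain and $p=1$. (ii) The system is not exponentially detectable. (iii) The system is exactly observable on every finite time interval. More precisely, for every $\tau>0$ there exists $C_\tau>0$ such that $$\int_0^\tau\|CT(t)x\|_Y^2\,\mathrm dt\ge C_\tau\|x\|_X^2,\quad x\in X.$$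
   Context: $\mathcal L(Y,X)$ denotes the bounded linear operators from $Y$ to $X$. $\mathbb R_+=[0,\infty)$; $\mathcal K_\infty$ is the set of continuous, strictly increasing, unbounded $\gamma:\mathbb R_+\to\mathbb R_+$ with $\gamma(0)=0$. The mild solution with initial state $x\in X$ is $\phi(t,x)=T(t)x$, $t\ge0$. Lie derivative: $\dot V(x):=\limsup_{\tau\to+0}\frac{V(\phi(\tau,x))-V(x)}{\tau}$ (limsup in the extended real line), provided $t\mapsto V(\phi(t,x))$ is continuous at $t=0$. $V:X\to\mathbb R_+$ is a coercive eOSS Lyapunov function in dissipation form if: (a) there exist $k_1,k_2,p>0$ with $k_1\|x\|_X^p\le V(x)\le k_2\|x\|_X^p$ for all $x\in X$; (b) for every $x\in X$ the map $t\mapsto V(\phi(t,x))$, $t\ge0$, is continuous; (c) there exist $\alpha>0$ and $\sigma\in\mathcal K_\infty$ such that, with $p$ as in (a), $\dot V(x)\le-\alpha\|x\|_X^p+\sigma(\|Cx\|_Y)$ for all $x\in X$. It has linear Lyapunov gain if $\sigma$ can be chosen linear. Exponentially detectable: there exists $L\in\mathcal L(Y,X)$ such that $A+LC$ generates a uniformly exponentially stable $C_0$-semigroup, i.e. a semigroup $S(\cdot)$ with $\|S(t)x\|_X\le Me^{-\mu t}\|x\|_X$ for all $x\in X$, $t\ge0$ and some $M,\mu>0$. *)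

theory Defs
  imports "HOL-Analysis.Analysis"
begin

section \<open>Complex normed spaces\<close>

text \<open>The real structure of a complex normed space is the restriction of scalars of its complex
  structure; in particular \<open>1 *\<^sub>C x = x\<close> follows from \<open>scaleC_of_real\<close>.\<close>

class complex_normed_vector = real_normed_vector +
  fixes scaleC :: "complex \<Rightarrow> 'a \<Rightarrow> 'a"  (infixr "*\<^sub>C" 75)
  assumes scaleC_add_right: "c *\<^sub>C (x + y) = c *\<^sub>C x + c *\<^sub>C y"
    and scaleC_add_left: "(c + d) *\<^sub>C x = c *\<^sub>C x + d *\<^sub>C x"
    and scaleC_scaleC: "c *\<^sub>C d *\<^sub>C x = (c * d) *\<^sub>C x"
    and scaleC_of_real: "complex_of_real r *\<^sub>C x = r *\<^sub>R x"
    and norm_scaleC: "norm (c *\<^sub>C x) = cmod c * norm x"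

definition bounded_clinear :: "('a::complex_normed_vector \<Rightarrow> 'b::complex_normed_vector) \<Rightarrow> bool"
  where "bounded_clinear f \<longleftrightarrow> bounded_linear f \<and> (\<forall>c x. f (c *\<^sub>C x) = c *\<^sub>C f x)"

instantiation complex :: complex_normed_vector
begin

definition scaleC_complex :: "complex \<Rightarrow> complex \<Rightarrow> complex"
  where "scaleC_complex c x = c * x"

instance
  by standard (simp_all add: scaleC_complex_def algebra_simps norm_mult scaleR_conv_of_real)

end

lemma scaleC_bcontfun_mem:
  fixes f :: "'a::topological_space \<Rightarrow>\<^sub>C 'b::complex_normed_vector"
  shows "(\<lambda>x. c *\<^sub>C apply_bcontfun f x) \<in> bcontfun"
proof (rule bcontfun_normI)
  have "bounded_linear (\<lambda>y::'b. c *\<^sub>C y)"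
  proof (rule bounded_linear_intro)
    show "c *\<^sub>C (r *\<^sub>R y) = r *\<^sub>R c *\<^sub>C y" for r and y :: 'b
      by (simp add: scaleC_of_real[symmetric] scaleC_scaleC mult.commute)
    show "norm (c *\<^sub>C y) \<le> norm y * cmod c" for y :: 'b
      by (simp add: norm_scaleC mult.commute)
  qed (simp add: scaleC_add_right)
  then show "continuous_on UNIV (\<lambda>x. c *\<^sub>C apply_bcontfun f x)"
    by (rule bounded_linear.continuous_on) simp
  show "norm (c *\<^sub>C apply_bcontfun f x) \<le> cmod c * norm f" for x
    by (simp add: norm_scaleC mult_left_mono norm_bounded)
qed

instantiation bcontfun :: (topological_space, complex_normed_vector) complex_normed_vector
begin

definition scaleC_bcontfun :: "complex \<Rightarrow> ('a \<Rightarrow>\<^sub>C 'b) \<Rightarrow> ('a \<Rightarrow>\<^sub>C 'b)"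
  where "scaleC_bcontfun c f = Bcontfun (\<lambda>x. c *\<^sub>C apply_bcontfun f x)"

lemma apply_scaleC_bcontfun [simp]: "apply_bcontfun (c *\<^sub>C f) x = c *\<^sub>C apply_bcontfun f x"
  for f :: "'a \<Rightarrow>\<^sub>C 'b"
  by (simp add: scaleC_bcontfun_def Bcontfun_inverse scaleC_bcontfun_mem)

instance
proof
  fix c d :: complex and r :: real and f g :: "'a \<Rightarrow>\<^sub>C 'b"
  have le: "norm (c *\<^sub>C f) \<le> cmod c * norm f" for c and f :: "'a \<Rightarrow>\<^sub>C 'b"
    by (rule norm_bound) (simp add: norm_scaleC mult_left_mono norm_bounded)
  show "norm (c *\<^sub>C f) = cmod c * norm f"
  proof (cases "c = 0")
    case False
    have "norm f = norm (inverse c *\<^sub>C (c *\<^sub>C f))"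
    proof (rule arg_cong[where f = norm], rule bcontfun_eqI)
      show "apply_bcontfun f x = apply_bcontfun (inverse c *\<^sub>C (c *\<^sub>C f)) x" for x
        using False scaleC_of_real[of 1 "apply_bcontfun f x"] by (simp add: scaleC_scaleC)
    qed
    also have "\<dots> \<le> cmod (inverse c) * norm (c *\<^sub>C f)"
      by (rule le)
    finally have "cmod c * norm f \<le> norm (c *\<^sub>C f)"
      using False by (simp add: norm_inverse norm_divide field_simps)
    with le[of c f] show ?thesis by simp
  qed (use le[of c f] in simp)
qed (auto intro!: bcontfun_eqI simp: scaleC_add_right scaleC_add_left scaleC_scaleC scaleC_of_real)

end

section \<open>The sequence spaces\<close>

text \<open>Since \<^typ>\<open>nat\<close> is discrete, every bounded sequence is a bounded continuous
  function, and the norm is the supremum norm.\<close>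

type_synonym linfty = "nat \<Rightarrow>\<^sub>C complex"

typedef ell2 = "{x :: nat \<Rightarrow> complex. summable (\<lambda>k. (cmod (x k))\<^sup>2)}"
  morphisms ell2_nth Abs_ell2
  by (rule exI[of _ "\<lambda>_. 0"]) simp

setup_lifting type_definition_ell2

lemma ell2_summable: "summable (\<lambda>k. (cmod (ell2_nth x k))\<^sup>2)"
  using ell2_nth by auto

lemma ell2_eqI: "(\<And>k. ell2_nth x k = ell2_nth y k) \<Longrightarrow> x = y"
  by transfer auto

definition cinner :: "ell2 \<Rightarrow> ell2 \<Rightarrow> complex"
  where "cinner x y = (\<Sum>k. ell2_nth x k * cnj (ell2_nth y k))"

lemma summable_cinner: "summable (\<lambda>k. ell2_nth x k * cnj (ell2_nth y k))"
proof (rule summable_comparison_test')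
  show "summable (\<lambda>k. (cmod (ell2_nth x k))\<^sup>2 + (cmod (ell2_nth y k))\<^sup>2)"
    by (intro summable_add ell2_summable)
  fix k
  have "0 \<le> (cmod (ell2_nth x k) - cmod (ell2_nth y k))\<^sup>2" 
    by simp
  moreover have "0 \<le> cmod (ell2_nth x k) * cmod (ell2_nth y k)"
    by simp
  ultimately show "norm (ell2_nth x k * cnj (ell2_nth y k))
      \<le> (cmod (ell2_nth x k))\<^sup>2 + (cmod (ell2_nth y k))\<^sup>2"
    unfolding norm_mult complex_mod_cnj power2_diff by linarith
qed

instantiation ell2 :: real_vector
begin

lift_definition zero_ell2 :: ell2 is "\<lambda>_. 0" by simp

lift_definition plus_ell2 :: "ell2 \<Rightarrow> ell2 \<Rightarrow> ell2" is "\<lambda>x y k. x k + y k"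
proof -
  fix x y :: "nat \<Rightarrow> complex"
  assume "summable (\<lambda>k. (cmod (x k))\<^sup>2)" and "summable (\<lambda>k. (cmod (y k))\<^sup>2)"
  then have "summable (\<lambda>k. 2 * (cmod (x k))\<^sup>2 + 2 * (cmod (y k))\<^sup>2)"
    by (intro summable_add summable_mult)
  then show "summable (\<lambda>k. (cmod (x k + y k))\<^sup>2)"
  proof (rule summable_comparison_test')
    fix k
    have "(cmod (x k + y k))\<^sup>2 \<le> (cmod (x k) + cmod (y k))\<^sup>2"
      by (intro power_mono norm_triangle_ineq) simp
    also have "\<dots> \<le> 2 * (cmod (x k))\<^sup>2 + 2 * (cmod (y k))\<^sup>2"
      using zero_le_power2[of "cmod (x k) - cmod (y k)"]
      unfolding power2_diff power2_sum by linarith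
    finally show "norm ((cmod (x k + y k))\<^sup>2) \<le> 2 * (cmod (x k))\<^sup>2 + 2 * (cmod (y k))\<^sup>2"
      by simp
  qed
qed

lift_definition uminus_ell2 :: "ell2 \<Rightarrow> ell2" is "\<lambda>x k. - x k" by simp

definition minus_ell2 :: "ell2 \<Rightarrow> ell2 \<Rightarrow> ell2"
  where "minus_ell2 x y = x + - y"

lift_definition scaleR_ell2 :: "real \<Rightarrow> ell2 \<Rightarrow> ell2" is "\<lambda>r x k. r *\<^sub>R x k"
  by (simp add: power_mult_distrib summable_mult)

instance
proof
  fix x y z :: ell2 and r s :: real
  show "x + y + z = x + (y + z)" "x + y = y + x" "0 + x = x" "- x + x = 0"
    by (transfer; simp add: add_ac)+
  show "x - y = x + - y"
    by (rule minus_ell2_def)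
  show "r *\<^sub>R (x + y) = r *\<^sub>R x + r *\<^sub>R y" "(r + s) *\<^sub>R x = r *\<^sub>R x + s *\<^sub>R x"
    "r *\<^sub>R s *\<^sub>R x = (r * s) *\<^sub>R x" "1 *\<^sub>R x = x"
    by (transfer; simp add: algebra_simps)+
qed

end

instantiation ell2 :: real_inner
begin

definition norm_ell2 :: "ell2 \<Rightarrow> real"
  where "norm_ell2 x = sqrt (\<Sum>k. (cmod (ell2_nth x k))\<^sup>2)"

definition inner_ell2 :: "ell2 \<Rightarrow> ell2 \<Rightarrow> real"
  where "inner_ell2 x y = Re (cinner x y)"

definition sgn_ell2 :: "ell2 \<Rightarrow> ell2"
  where "sgn_ell2 x = x /\<^sub>R norm x"

definition dist_ell2 :: "ell2 \<Rightarrow> ell2 \<Rightarrow> real"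
  where "dist_ell2 x y = norm (x - y)"

definition uniformity_ell2 :: "(ell2 \<times> ell2) filter"
  where "uniformity_ell2 = (INF e\<in>{0<..}. principal {(x, y). dist x y < e})"

definition open_ell2 :: "ell2 set \<Rightarrow> bool"
  where "open_ell2 U \<longleftrightarrow> (\<forall>x\<in>U. \<forall>\<^sub>F (x', y) in uniformity. x' = x \<longrightarrow> y \<in> U)"

lemma cinner_self: "cinner x x = complex_of_real (\<Sum>k. (cmod (ell2_nth x k))\<^sup>2)"
  unfolding cinner_def
  by (simp add: complex_norm_square[symmetric] suminf_of_real ell2_summable flip: of_real_power)

instance
proof
  fix x y z :: ell2 and r :: real
  show "inner x y = inner y x"
  proof -
    have "cnj (cinner y x) = cinner x y"
      unfolding cinner_def
      by (simp add: bounded_linear.suminf[OF bounded_linear_cnj summable_cinner] mult.commute)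
    then have "Re (cnj (cinner y x)) = Re (cinner x y)"
      by (rule arg_cong)
    then show ?thesis
      by (simp add: inner_ell2_def)
  qed
  show "inner (x + y) z = inner x z + inner y z"
    unfolding inner_ell2_def cinner_def plus_ell2.rep_eq
    by (simp add: distrib_right suminf_add[OF summable_cinner summable_cinner, symmetric])
  show "inner (r *\<^sub>R x) y = r * inner x y"
    unfolding inner_ell2_def cinner_def scaleR_ell2.rep_eq
    using suminf_mult[OF summable_cinner, of "of_real r" x y]
    by (simp add: scaleR_conv_of_real mult.assoc)
  show "0 \<le> inner x x"
    by (simp add: inner_ell2_def cinner_self suminf_nonneg ell2_summable)
  show "inner x x = 0 \<longleftrightarrow> x = 0"
    by (auto simp: inner_ell2_def cinner_self suminf_eq_zero_iff ell2_summable zero_ell2.rep_eq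
        intro: ell2_eqI)
  show "norm x = sqrt (inner x x)"
    by (simp add: norm_ell2_def inner_ell2_def cinner_self)
qed (rule sgn_ell2_def dist_ell2_def uniformity_ell2_def open_ell2_def)+

end

instantiation ell2 :: complex_normed_vector
begin

lift_definition scaleC_ell2 :: "complex \<Rightarrow> ell2 \<Rightarrow> ell2" is "\<lambda>c x k. c * x k"
  by (simp add: norm_mult power_mult_distrib summable_mult)

instance
proof
  fix x y :: ell2 and c d :: complex and r :: real
  show "c *\<^sub>C (x + y) = c *\<^sub>C x + c *\<^sub>C y" "(c + d) *\<^sub>C x = c *\<^sub>C x + d *\<^sub>C x"
    "c *\<^sub>C d *\<^sub>C x = (c * d) *\<^sub>C x" "complex_of_real r *\<^sub>C x = r *\<^sub>R x"
    by (transfer; simp add: algebra_simps scaleR_conv_of_real)+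
  show "norm (c *\<^sub>C x) = cmod c * norm x"
    by (simp add: norm_ell2_def scaleC_ell2.rep_eq norm_mult power_mult_distrib
        suminf_mult ell2_summable real_sqrt_mult)
qed

end

lemma cinner_scaleC_left: "cinner (c *\<^sub>C x) y = c * cinner x y"
  by (simp add: cinner_def scaleC_ell2.rep_eq mult.assoc suminf_mult[OF summable_cinner])

lemma norm_cinner_le: "cmod (cinner x y) \<le> norm x * norm y"
proof (cases "cinner x y = 0")
  case False
  define u where "u = cnj (cinner x y) / cmod (cinner x y)"
  have "cmod u = 1"
    using False by (simp add: u_def norm_divide)
  have "cinner (u *\<^sub>C x) y = cmod (cinner x y)"
    using False complex_norm_square[of "cinner x y"] unfolding cinner_scaleC_left u_def
    by (simp add: divide_simps power2_eq_square mult.commute)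
  then have "cmod (cinner x y) = inner (u *\<^sub>C x) y"
    by (simp add: inner_ell2_def)
  also have "\<dots> \<le> norm (u *\<^sub>C x) * norm y"
    by (rule norm_cauchy_schwarz)
  finally show ?thesis
    using \<open>cmod u = 1\<close> by (simp add: norm_scaleC)
qed simp

section \<open>Semigroups and generators\<close>

definition C0_semigroup :: "(real \<Rightarrow> 'a::complex_normed_vector \<Rightarrow> 'a) \<Rightarrow> bool"
  where "C0_semigroup T \<longleftrightarrow>
    (\<forall>t\<ge>0. bounded_clinear (T t)) \<and>
    T 0 = id \<and>
    (\<forall>s\<ge>0. \<forall>t\<ge>0. T (s + t) = T s \<circ> T t) \<and>
    (\<forall>x. ((\<lambda>t. T t x) \<longlongrightarrow> x) (at_right 0))"

text \<open>An operator is given by its domain \<open>D\<close> and a function \<open>A\<close>, of which only the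
  values on \<open>D\<close> matter.\<close>

definition generates ::
    "'a::complex_normed_vector set \<Rightarrow> ('a \<Rightarrow> 'a) \<Rightarrow> (real \<Rightarrow> 'a \<Rightarrow> 'a) \<Rightarrow> bool"
  where "generates D A T \<longleftrightarrow>
    C0_semigroup T \<and>
    D = {x. \<exists>y. ((\<lambda>t. (T t x - x) /\<^sub>R t) \<longlongrightarrow> y) (at_right 0)} \<and>
    (\<forall>x\<in>D. ((\<lambda>t. (T t x - x) /\<^sub>R t) \<longlongrightarrow> A x) (at_right 0))"

definition uniformly_exp_stable :: "(real \<Rightarrow> 'a::complex_normed_vector \<Rightarrow> 'a) \<Rightarrow> bool"
  where "uniformly_exp_stable S \<longleftrightarrow>
    (\<exists>M>0. \<exists>\<mu>>0. \<forall>x. \<forall>t\<ge>0. norm (S t x) \<le> M * exp (- \<mu> * t) * norm x)"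

text \<open>The output operator is meant to be bounded, so \<open>A + L C\<close> has the domain \<open>D\<close> of \<open>A\<close>.\<close>

definition exp_detectable ::
    "'a::complex_normed_vector set \<Rightarrow> ('a \<Rightarrow> 'a) \<Rightarrow> ('a \<Rightarrow> 'b::complex_normed_vector) \<Rightarrow> bool"
  where "exp_detectable D A C \<longleftrightarrow>
    (\<exists>L. bounded_clinear L \<and>
      (\<exists>S. generates D (\<lambda>x. A x + L (C x)) S \<and> uniformly_exp_stable S))"

section \<open>Lyapunov functions\<close>

definition K_infinity :: "(real \<Rightarrow> real) set"
  where "K_infinity = {\<gamma>. \<gamma> ` {0..} \<subseteq> {0..} \<and> continuous_on {0..} \<gamma> \<and>
    strict_mono_on {0..} \<gamma> \<and> \<not> bdd_above (\<gamma> ` {0..}) \<and> \<gamma> 0 = 0}"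

definition lie_derivative :: "(real \<Rightarrow> 'a \<Rightarrow> 'a) \<Rightarrow> ('a \<Rightarrow> real) \<Rightarrow> 'a \<Rightarrow> ereal"
  where "lie_derivative T V x = Limsup (at_right 0) (\<lambda>\<tau>. ereal ((V (T \<tau> x) - V x) / \<tau>))"

text \<open>Exponent \<open>p\<close> and gain \<open>\<sigma>\<close> are parameters, so that further properties can be
  required of them. Note that \<open>0 powr p = 0\<close>.\<close>

definition coercive_eOSS_Lyapunov_dissipation ::
    "(real \<Rightarrow> 'a::complex_normed_vector \<Rightarrow> 'a) \<Rightarrow> ('a \<Rightarrow> 'b::complex_normed_vector) \<Rightarrow>
      ('a \<Rightarrow> real) \<Rightarrow> real \<Rightarrow> (real \<Rightarrow> real) \<Rightarrow> bool"
  where "coercive_eOSS_Lyapunov_dissipation T C V p \<sigma> \<longleftrightarrow>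
    (\<forall>x. 0 \<le> V x) \<and> p > 0 \<and>
    (\<exists>k1>0. \<exists>k2>0. \<forall>x. k1 * norm x powr p \<le> V x \<and> V x \<le> k2 * norm x powr p) \<and>
    (\<forall>x. continuous_on {0..} (\<lambda>t. V (T t x))) \<and>
    \<sigma> \<in> K_infinity \<and>
    (\<exists>\<alpha>>0. \<forall>x. lie_derivative T V x \<le> ereal (- \<alpha> * norm x powr p + \<sigma> (norm (C x))))"

definition linear_gain :: "(real \<Rightarrow> real) \<Rightarrow> bool"
  where "linear_gain \<sigma> \<longleftrightarrow> (\<exists>c. \<forall>r\<ge>0. \<sigma> r = c * r)"

section \<open>The system\<close>

definition coefficient_map :: "(nat \<Rightarrow> ell2) \<Rightarrow> ell2 \<Rightarrow> linfty"
  where "coefficient_map z x = Bcontfun (\<lambda>k. cinner x (z k))"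

lemma apply_coefficient_map:
  assumes "range z \<subseteq> sphere 0 1"
  shows "apply_bcontfun (coefficient_map z x) k = cinner x (z k)"
proof -
  have "(\<lambda>k. cinner x (z k)) \<in> bcontfun"
  proof (rule bcontfun_normI)
    show "norm (cinner x (z k)) \<le> norm x" for k
      using norm_cinner_le[of x "z k"] assms by (auto simp: image_subset_iff)
  qed simp
  then show ?thesis
    by (simp add: coefficient_map_def Bcontfun_inverse)
qed

lemma generates_zero: "generates UNIV (\<lambda>_::'a::complex_normed_vector. 0) (\<lambda>t x. x)"
  by (auto simp: generates_def C0_semigroup_def bounded_clinear_def bounded_linear_ident
      fun_eq_iff)

end

theory Submission
  imports Defs
begin

text \<open>Since \<open>C\<close> is an isometry and the flow is trivial, the observability inequality and the
  Lyapunov function \<open>V x = \<parallel>x\<parallel>\<close> with gain \<open>\<sigma> r = r\<close> are immediate: the Lie derivative vanishes and so does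
  \<open>- \<parallel>x\<parallel> + \<parallel>C x\<parallel>\<close>. That \<open>C\<close> does not shrink a vector \<open>x\<close> follows by
  testing it against points \<open>z\<^sub>k\<close> close to \<open>x / \<parallel>x\<parallel>\<close>.

  The substance is that the system is not exponentially detectable. The conceptual reason is that
  a stabilizing \<open>L\<close> makes \<open>L C\<close> invertible, so that \<open>C\<close> embeds
  \<open>ell2\<close> as a complemented subspace of \<open>linfty\<close>, which is impossible. The proof
  below makes this quantitative through traces of \<open>n \<times> n\<close> corners. Let
  \<open>S\<close> be an exponentially stable semigroup generated by \<open>L C\<close> and put
  \<open>h s = (\<Sum>i<n. \<langle>S s e\<^sub>i, e\<^sub>i\<rangle>)\<close>. Then \<open>h 0 = n\<close>, whereas
  \<open>\<bar>h t\<bar> \<le> n / 2\<close> for a time \<open>t\<close> that does not depend on \<open>n\<close>. On the other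
  hand \<open>h' s = (\<Sum>i<n. \<langle>S s L C e\<^sub>i, e\<^sub>i\<rangle>)\<close> is the trace of an operator
  that factors through \<open>linfty\<close>, and such traces are only of the order \<open>sqrt n\<close>
  (\<open>trace_through_linfty_le\<close>). Hence \<open>n / 2 \<le> t K sqrt n\<close> with
  \<open>K\<close> independent of \<open>n\<close>, which fails for large \<open>n\<close>.

  The bound on traces rests on Riesz products. Let \<open>w\<^sub>1, \<dots>, w\<^sub>n\<close> be real sequences with
  \<open>(\<Sum>i. w\<^sub>i\<^sup>2) \<le> 1\<close> pointwise. For signs \<open>\<epsilon>\<close> the product
  \<open>G\<^sub>\<epsilon> = (\<Prod>j. 1 + \<i> \<epsilon>\<^sub>j w\<^sub>j)\<close> has modulus
  \<open>sqrt (\<Prod>j. 1 + w\<^sub>j\<^sup>2) \<le> exp (1 / 2)\<close>, and the mean of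
  \<open>\<epsilon>\<^sub>i G\<^sub>\<epsilon>\<close> over all signs is \<open>\<i> w\<^sub>i\<close>. So
  \<open>\<i> (\<Sum>i. \<langle>\<Lambda> w\<^sub>i, e\<^sub>i\<rangle>)\<close> is the mean of
  \<open>\<langle>\<Lambda> G\<^sub>\<epsilon>, \<Sum>i. \<epsilon>\<^sub>i e\<^sub>i\<rangle>\<close>, which is at most
  \<open>\<parallel>\<Lambda>\<parallel> exp (1 / 2) sqrt n\<close>. It applies to the real and imaginary parts of
  \<open>C e\<^sub>i\<close>, as \<open>(\<Sum>i. \<bar>(C e\<^sub>i)\<^sub>k\<bar>\<^sup>2) \<le> \<parallel>z\<^sub>k\<parallel>\<^sup>2 = 1\<close>.\<close>

section \<open>Coordinates in \<open>ell2\<close>\<close>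

lemma ell2_nth_sum: "ell2_nth (sum f A) i = (\<Sum>a\<in>A. ell2_nth (f a) i)"
  by (induction A rule: infinite_finite_induct)
    (simp_all add: zero_ell2.rep_eq plus_ell2.rep_eq)

lemma sum_cmod_ell2_nth_le:
  assumes "finite A"
  shows "(\<Sum>i\<in>A. (cmod (ell2_nth x i))\<^sup>2) \<le> (norm x)\<^sup>2"
proof -
  have "(norm x)\<^sup>2 = (\<Sum>k. (cmod (ell2_nth x k))\<^sup>2)"
    by (simp add: norm_ell2_def suminf_nonneg ell2_summable)
  with sum_le_suminf[OF ell2_summable assms] show ?thesis
    by simp
qed

lemma cmod_ell2_nth_le: "cmod (ell2_nth x i) \<le> norm x"
  using sum_cmod_ell2_nth_le[of "{i}" x] by (simp add: power2_le_iff_abs_le)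

lemma sum_cmod_ell2_nth_le_sqrt_card:
  assumes "finite A"
  shows "(\<Sum>i\<in>A. cmod (ell2_nth x i)) \<le> sqrt (card A) * norm x"
proof -
  have "(\<Sum>i\<in>A. \<bar>1\<bar> * \<bar>cmod (ell2_nth x i)\<bar>)
      \<le> L2_set (\<lambda>_. 1) A * L2_set (\<lambda>i. cmod (ell2_nth x i)) A"
    by (rule L2_set_mult_ineq)
  also have "L2_set (\<lambda>_. 1) A = sqrt (card A)"
    by (simp add: L2_set_def)
  also have "L2_set (\<lambda>i. cmod (ell2_nth x i)) A \<le> norm x"
    unfolding L2_set_def by (rule real_le_lsqrt) (use sum_cmod_ell2_nth_le[OF assms] in auto)
  finally show ?thesis
    by (simp add: mult_left_mono)
qed

lemma bounded_linear_ell2_nth: "bounded_linear (\<lambda>x. ell2_nth x i)"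
  by (rule bounded_linear_intro[of _ 1])
    (simp_all add: plus_ell2.rep_eq scaleR_ell2.rep_eq cmod_ell2_nth_le)

lift_definition unit_ell2 :: "nat \<Rightarrow> ell2" is "\<lambda>i k. if k = i then 1 else 0"
proof -
  fix i
  show "summable (\<lambda>k. (cmod (if k = i then 1 else 0))\<^sup>2)"
    by (rule summable_finite[of "{i}"]) auto
qed

lemma ell2_nth_unit: "ell2_nth (unit_ell2 i) k = (if k = i then 1 else 0)"
  by (simp add: unit_ell2.rep_eq)

lemma norm_unit_ell2: "norm (unit_ell2 i) = 1"
proof -
  have "(\<Sum>k. (cmod (ell2_nth (unit_ell2 i) k))\<^sup>2) = (\<Sum>k\<in>{i}. (cmod (ell2_nth (unit_ell2 i) k))\<^sup>2)"
    by (rule suminf_finite) (auto simp: ell2_nth_unit)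
  then show ?thesis
    by (simp add: norm_ell2_def ell2_nth_unit)
qed

lemma cinner_unit_ell2: "cinner (unit_ell2 i) x = cnj (ell2_nth x i)"
proof -
  have "cinner (unit_ell2 i) x = (\<Sum>k\<in>{i}. ell2_nth (unit_ell2 i) k * cnj (ell2_nth x k))"
    unfolding cinner_def by (rule suminf_finite) (auto simp: ell2_nth_unit)
  then show ?thesis
    by (simp add: ell2_nth_unit)
qed

lemma cinner_add_left: "cinner (x + y) z = cinner x z + cinner y z"
  by (simp add: cinner_def plus_ell2.rep_eq distrib_right
      suminf_add[OF summable_cinner summable_cinner])

section \<open>The coefficient map is an isometry\<close>

text \<open>The real half-space \<open>inner x y \<le> \<parallel>C x\<parallel>\<close> is closed in \<open>y\<close> and contains
  every \<open>z k\<close>, hence by density the whole unit sphere, in particular \<open>x / \<parallel>x\<parallel>\<close>.\<close>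

lemma norm_coefficient_map:
  assumes z_sphere: "range z \<subseteq> sphere 0 1" and z_dense: "sphere 0 1 \<subseteq> closure (range z)"
  shows "norm (coefficient_map z x) = norm x"
proof (rule antisym)
  note coeff = apply_coefficient_map[OF z_sphere]
  have z1: "norm (z k) = 1" for k
    using z_sphere by (auto simp: image_subset_iff)
  show "norm (coefficient_map z x) \<le> norm x"
  proof (rule norm_bound)
    show "norm (apply_bcontfun (coefficient_map z x) k) \<le> norm x" for k
      using norm_cinner_le[of x "z k"] by (simp add: coeff z1)
  qed
  show "norm x \<le> norm (coefficient_map z x)"
  proof (cases "x = 0")
    case False
    have "closure (range z) \<subseteq> {y. inner x y \<le> norm (coefficient_map z x)}"
    proof (rule closure_minimal)
      show "range z \<subseteq> {y. inner x y \<le> norm (coefficient_map z x)}"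
      proof clarify
        fix k
        have "inner x (z k) \<le> cmod (cinner x (z k))"
          by (simp add: inner_ell2_def complex_Re_le_cmod)
        also have "\<dots> \<le> norm (coefficient_map z x)"
          using norm_bounded[of "coefficient_map z x" k] by (simp add: coeff)
        finally show "inner x (z k) \<le> norm (coefficient_map z x)" .
      qed
    qed (intro closed_Collect_le continuous_intros)
    moreover have "x /\<^sub>R norm x \<in> sphere 0 1"
      using False by simp
    ultimately have "inner x (x /\<^sub>R norm x) \<le> norm (coefficient_map z x)"
      using z_dense by blast
    then show ?thesis
      using False by (simp add: power2_norm_eq_inner[symmetric] power2_eq_square field_simps)
  qed simp
qed

lemma bounded_clinear_coefficient_map:
  assumes "range z \<subseteq> sphere 0 1"
  shows "bounded_clinear (coefficient_map z)"
proof -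
  note coeff = apply_coefficient_map[OF assms]
  have z1: "norm (z k) = 1" for k
    using assms by (auto simp: image_subset_iff)
  have scaleC: "coefficient_map z (c *\<^sub>C x) = c *\<^sub>C coefficient_map z x" for c x
    by (rule bcontfun_eqI) (simp add: coeff cinner_scaleC_left scaleC_complex_def)
  have "bounded_linear (coefficient_map z)"
  proof (rule bounded_linear_intro)
    show "coefficient_map z (x + y) = coefficient_map z x + coefficient_map z y" for x y
      by (rule bcontfun_eqI) (simp add: coeff cinner_add_left)
    show "coefficient_map z (r *\<^sub>R x) = r *\<^sub>R coefficient_map z x" for r x
      using scaleC[of "complex_of_real r" x] by (simp add: scaleC_of_real)
    show "norm (coefficient_map z x) \<le> norm x * 1" for x
    proof (rule norm_bound)
      show "norm (apply_bcontfun (coefficient_map z x) k) \<le> norm x * 1" for k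
        using norm_cinner_le[of x "z k"] by (simp add: coeff z1)
    qed
  qed
  then show ?thesis
    by (simp add: bounded_clinear_def scaleC)
qed

section \<open>Riesz products\<close>

text \<open>A choice of signs on \<open>A\<close> is encoded as the set \<open>S \<subseteq> A\<close> of indices that carry a plus
  sign; averages over signs become sums over \<open>Pow A\<close>.\<close>

definition sign_of :: "'i set \<Rightarrow> 'i \<Rightarrow> complex"
  where "sign_of S i = (if i \<in> S then 1 else - 1)"

definition riesz_product :: "'i set \<Rightarrow> ('i \<Rightarrow> real) \<Rightarrow> 'i set \<Rightarrow> complex"
  where "riesz_product A w S = (\<Prod>j\<in>A. 1 + \<i> * sign_of S j * of_real (w j))"

text \<open>The imaginary unit in the factors is what keeps the product bounded:
  \<open>\<bar>1 \<plusminus> \<i> w\<bar>\<^sup>2 = 1 + w\<^sup>2\<close> has no term linear in \<open>w\<close>, so that only the sum of the squares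
  enters.\<close>

lemma cmod_riesz_product_le:
  assumes "finite A" and "(\<Sum>j\<in>A. (w j)\<^sup>2) \<le> 1"
  shows "cmod (riesz_product A w S) \<le> exp (1 / 2)"
proof -
  have factor: "cmod (1 + \<i> * sign_of S j * of_real (w j)) \<le> exp ((w j)\<^sup>2 / 2)" for j
  proof (rule power2_le_imp_le)
    have "(cmod (1 + \<i> * sign_of S j * of_real (w j)))\<^sup>2 = 1 + (w j)\<^sup>2"
      by (simp add: cmod_power2 sign_of_def)
    also have "\<dots> \<le> exp ((w j)\<^sup>2)"
      by (rule exp_ge_add_one_self)
    also have "\<dots> = (exp ((w j)\<^sup>2 / 2))\<^sup>2"
      by (simp add: exp_double[symmetric])
    finally show "(cmod (1 + \<i> * sign_of S j * of_real (w j)))\<^sup>2 \<le> (exp ((w j)\<^sup>2 / 2))\<^sup>2" .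
  qed simp
  have "cmod (riesz_product A w S) \<le> (\<Prod>j\<in>A. exp ((w j)\<^sup>2 / 2))"
    unfolding riesz_product_def prod_norm[symmetric] by (intro prod_mono conjI norm_ge_zero factor)
  also have "\<dots> = exp ((\<Sum>j\<in>A. (w j)\<^sup>2) / 2)"
    by (simp add: exp_sum[OF assms(1)] sum_divide_distrib)
  also have "\<dots> \<le> exp (1 / 2)"
    using assms(2) by simp
  finally show ?thesis .
qed

lemma sum_Pow_insert:
  fixes F :: "'i set \<Rightarrow> 'b::comm_monoid_add"
  assumes "finite A" "a \<notin> A"
  shows "sum F (Pow (insert a A)) = (\<Sum>S\<in>Pow A. F S + F (insert a S))"
proof -
  have inj: "inj_on (insert a) (Pow A)"
    using assms(2) by (auto simp: inj_on_def)
  have "sum F (Pow (insert a A)) = sum F (Pow A) + sum F (insert a ` Pow A)"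
    unfolding Pow_insert by (rule sum.union_disjoint) (use assms in auto)
  then show ?thesis
    by (simp add: sum.reindex[OF inj] sum.distrib)
qed

lemma riesz_product_insert:
  assumes "finite A" "a \<notin> A" "S \<subseteq> A"
  shows "riesz_product (insert a A) w S = (1 - \<i> * of_real (w a)) * riesz_product A w S"
    and "riesz_product (insert a A) w (insert a S) = (1 + \<i> * of_real (w a)) * riesz_product A w S"
proof -
  have "a \<notin> S"
    using assms by auto
  then show "riesz_product (insert a A) w S = (1 - \<i> * of_real (w a)) * riesz_product A w S"
    using assms(1,2) by (simp add: riesz_product_def sign_of_def)
  have "(\<Prod>j\<in>A. 1 + \<i> * sign_of (insert a S) j * of_real (w j)) = riesz_product A w S"
    unfolding riesz_product_def using assms(2) by (intro prod.cong) (auto simp: sign_of_def)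
  then show "riesz_product (insert a A) w (insert a S) =
      (1 + \<i> * of_real (w a)) * riesz_product A w S"
    using assms(1,2) by (simp add: riesz_product_def sign_of_def)
qed

text \<open>In the mean over all signs the factors are independent and each has mean 1. A factor that
  is weighted with its own sign has mean \<open>\<i> w\<^sub>i\<close> instead. This makes the \<open>w\<^sub>i\<close> recoverable
  from the uniformly bounded products.\<close>

lemma sum_riesz_product:
  assumes "finite A"
  shows "(\<Sum>S\<in>Pow A. riesz_product A w S) = 2 ^ card A"
  using assms
proof (induction A rule: finite_induct)
  case (insert a A)
  have "(\<Sum>S\<in>Pow (insert a A). riesz_product (insert a A) w S) =
      (\<Sum>S\<in>Pow A. 2 * riesz_product A w S)"
    unfolding sum_Pow_insert[OF insert.hyps]
    by (intro sum.cong) (use insert.hyps in \<open>auto simp: riesz_product_insert algebra_simps\<close>)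
  then show ?case
    using insert by (simp add: sum_distrib_left[symmetric])
qed (simp add: riesz_product_def)

lemma sum_sign_riesz_product:
  assumes "finite A" "i \<in> A"
  shows "(\<Sum>S\<in>Pow A. sign_of S i * riesz_product A w S) = 2 ^ card A * \<i> * of_real (w i)"
  using assms
proof (induction A rule: finite_induct)
  case (insert a A)
  note split = sum_Pow_insert[OF insert.hyps]
  show ?case
  proof (cases "i = a")
    case True
    have "(\<Sum>S\<in>Pow (insert a A). sign_of S i * riesz_product (insert a A) w S) =
        (\<Sum>S\<in>Pow A. 2 * \<i> * of_real (w i) * riesz_product A w S)"
      unfolding split
      by (intro sum.cong)
        (use insert.hyps True in \<open>auto simp: riesz_product_insert sign_of_def algebra_simps\<close>)
    also have "\<dots> = 2 * \<i> * of_real (w i) * 2 ^ card A"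
      by (simp only: sum_distrib_left[symmetric] sum_riesz_product[OF insert.hyps(1)])
    finally show ?thesis
      using insert.hyps by simp
  next
    case False
    then have "i \<in> A"
      using insert.prems by simp
    have "(\<Sum>S\<in>Pow (insert a A). sign_of S i * riesz_product (insert a A) w S) =
        (\<Sum>S\<in>Pow A. 2 * (sign_of S i * riesz_product A w S))"
      unfolding split
      by (intro sum.cong)
        (use insert.hyps False in \<open>auto simp: riesz_product_insert sign_of_def algebra_simps\<close>)
    then show ?thesis
      using insert.hyps insert.IH[OF \<open>i \<in> A\<close>] by (simp add: sum_distrib_left[symmetric])
  qed
qed simp

section \<open>Traces of operators that factor through \<open>linfty\<close>\<close>

lemma apply_Bcontfun_nat:
  fixes f :: "nat \<Rightarrow> complex"
  assumes "\<And>k. cmod (f k) \<le> b"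
  shows "apply_bcontfun (Bcontfun f) = f"
  by (rule Bcontfun_inverse, rule bcontfun_normI[of _ b]) (use assms in simp_all)

lemma norm_Bcontfun_nat_le:
  fixes f :: "nat \<Rightarrow> complex"
  assumes "\<And>k. cmod (f k) \<le> b"
  shows "norm (Bcontfun f) \<le> b"
  by (rule norm_bound) (use assms in \<open>simp add: apply_Bcontfun_nat[OF assms]\<close>)

lemma apply_bcontfun_sum: "apply_bcontfun (sum f A) k = (\<Sum>a\<in>A. apply_bcontfun (f a) k)"
  by (induction A rule: infinite_finite_induct) simp_all

lemma bounded_clinear_sum_scaleC:
  assumes "bounded_clinear f"
  shows "f (\<Sum>a\<in>A. c a *\<^sub>C g a) = (\<Sum>a\<in>A. c a *\<^sub>C f (g a))"
  using assms by (simp add: bounded_clinear_def linear_sum[OF bounded_linear.linear])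

text \<open>The naive bound is \<open>K * card A\<close>, obtained summand by summand. To gain the square root, all
  \<open>W i\<close> are written as averages of the same functions \<open>G S\<close>, so that \<open>\<Lambda>\<close> is applied to one
  bounded function at a time and the coordinates of its image can be summed by the
  Cauchy-Schwarz inequality.\<close>

lemma trace_through_linfty_le_real:
  fixes W :: "nat \<Rightarrow> linfty" and w :: "nat \<Rightarrow> nat \<Rightarrow> real"
  assumes "bounded_clinear \<Lambda>" and bound: "\<And>g. norm (\<Lambda> g) \<le> K * norm g"
    and K: "0 \<le> K" and "finite A"
    and W: "\<And>i k. i \<in> A \<Longrightarrow> apply_bcontfun (W i) k = of_real (w i k)"
    and w: "\<And>k. (\<Sum>i\<in>A. (w i k)\<^sup>2) \<le> 1"
  shows "cmod (\<Sum>i\<in>A. ell2_nth (\<Lambda> (W i)) i) \<le> K * exp (1 / 2) * sqrt (card A)"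
proof -
  define G :: "nat set \<Rightarrow> linfty"
    where "G S = Bcontfun (\<lambda>k. riesz_product A (\<lambda>i. w i k) S)" for S
  have G_le: "cmod (riesz_product A (\<lambda>i. w i k) S) \<le> exp (1 / 2)" for k S
    by (rule cmod_riesz_product_le[OF \<open>finite A\<close> w])
  have G_apply: "apply_bcontfun (G S) k = riesz_product A (\<lambda>i. w i k) S" for S k
    unfolding G_def by (subst apply_Bcontfun_nat[OF G_le]) simp
  have recover: "(2 ^ card A * \<i>) *\<^sub>C W i = (\<Sum>S\<in>Pow A. sign_of S i *\<^sub>C G S)" if "i \<in> A" for i
    by (rule bcontfun_eqI)
      (simp add: apply_bcontfun_sum W G_apply scaleC_complex_def that
        sum_sign_riesz_product[OF \<open>finite A\<close> that])
  have "2 ^ card A * \<i> * ell2_nth (\<Lambda> (W i)) i =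
      (\<Sum>S\<in>Pow A. sign_of S i * ell2_nth (\<Lambda> (G S)) i)" if "i \<in> A" for i
  proof -
    have "2 ^ card A * \<i> * ell2_nth (\<Lambda> (W i)) i = ell2_nth (\<Lambda> ((2 ^ card A * \<i>) *\<^sub>C W i)) i"
      using assms(1) by (simp add: bounded_clinear_def scaleC_ell2.rep_eq)
    then show ?thesis
      by (simp add: recover[OF that] bounded_clinear_sum_scaleC[OF assms(1)] ell2_nth_sum
          scaleC_ell2.rep_eq)
  qed
  then have "2 ^ card A * \<i> * (\<Sum>i\<in>A. ell2_nth (\<Lambda> (W i)) i) =
      (\<Sum>i\<in>A. \<Sum>S\<in>Pow A. sign_of S i * ell2_nth (\<Lambda> (G S)) i)"
    by (simp add: sum_distrib_left)
  also have "\<dots> = (\<Sum>S\<in>Pow A. \<Sum>i\<in>A. sign_of S i * ell2_nth (\<Lambda> (G S)) i)"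
    by (rule sum.swap)
  finally have "2 ^ card A * cmod (\<Sum>i\<in>A. ell2_nth (\<Lambda> (W i)) i) =
      cmod (\<Sum>S\<in>Pow A. \<Sum>i\<in>A. sign_of S i * ell2_nth (\<Lambda> (G S)) i)"
    by (metis (no_types, lifting) mult.right_neutral norm_ii norm_mult norm_numeral norm_power)
  also have "\<dots> \<le> (\<Sum>S\<in>Pow A. K * exp (1 / 2) * sqrt (card A))"
  proof (rule sum_norm_le)
    fix S
    have "cmod (\<Sum>i\<in>A. sign_of S i * ell2_nth (\<Lambda> (G S)) i) \<le> (\<Sum>i\<in>A. cmod (ell2_nth (\<Lambda> (G S)) i))"
      by (rule sum_norm_le) (simp add: norm_mult sign_of_def)
    also have "\<dots> \<le> sqrt (card A) * norm (\<Lambda> (G S))"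
      by (rule sum_cmod_ell2_nth_le_sqrt_card[OF \<open>finite A\<close>])
    also have "\<dots> \<le> sqrt (card A) * (K * exp (1 / 2))"
    proof (rule mult_left_mono)
      have "norm (G S) \<le> exp (1 / 2)"
        unfolding G_def by (rule norm_Bcontfun_nat_le[OF G_le])
      then show "norm (\<Lambda> (G S)) \<le> K * exp (1 / 2)"
        using bound[of "G S"] mult_left_mono[OF _ K] by fastforce
    qed simp
    finally show "cmod (\<Sum>i\<in>A. sign_of S i * ell2_nth (\<Lambda> (G S)) i)
        \<le> K * exp (1 / 2) * sqrt (card A)"
      by (simp add: mult_ac)
  qed
  also have "\<dots> = 2 ^ card A * (K * exp (1 / 2) * sqrt (card A))"
    by (simp add: card_Pow[OF \<open>finite A\<close>])
  finally show ?thesis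
    by simp
qed

lemma trace_through_linfty_le:
  fixes f :: "nat \<Rightarrow> linfty"
  assumes "bounded_clinear \<Lambda>" and bound: "\<And>g. norm (\<Lambda> g) \<le> K * norm g"
    and K: "0 \<le> K" and "finite A"
    and f: "\<And>k. (\<Sum>i\<in>A. (cmod (apply_bcontfun (f i) k))\<^sup>2) \<le> 1"
  shows "cmod (\<Sum>i\<in>A. ell2_nth (\<Lambda> (f i)) i) \<le> 2 * K * exp (1 / 2) * sqrt (card A)"
proof -
  define U :: "nat \<Rightarrow> linfty" where "U i = Bcontfun (\<lambda>k. complex_of_real (Re (apply_bcontfun (f i) k)))" for i
  define V :: "nat \<Rightarrow> linfty" where "V i = Bcontfun (\<lambda>k. complex_of_real (Im (apply_bcontfun (f i) k)))" for i
  have U_apply: "apply_bcontfun (U i) k = of_real (Re (apply_bcontfun (f i) k))" for i k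
    unfolding U_def
    by (subst apply_Bcontfun_nat[of _ "norm (f i)"])
      (auto intro: order_trans[OF abs_Re_le_cmod norm_bounded])
  have V_apply: "apply_bcontfun (V i) k = of_real (Im (apply_bcontfun (f i) k))" for i k
    unfolding V_def
    by (subst apply_Bcontfun_nat[of _ "norm (f i)"])
      (auto intro: order_trans[OF abs_Im_le_cmod norm_bounded])
  have f_eq: "f i = U i + \<i> *\<^sub>C V i" for i
    by (rule bcontfun_eqI) (simp add: U_apply V_apply scaleC_complex_def complex_eq[symmetric])
  have split: "ell2_nth (\<Lambda> (f i)) i = ell2_nth (\<Lambda> (U i)) i + \<i> * ell2_nth (\<Lambda> (V i)) i" for i
    unfolding f_eq using assms(1)
    by (simp add: bounded_clinear_def linear_add[OF bounded_linear.linear] plus_ell2.rep_eq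
        scaleC_ell2.rep_eq)
  have "cmod (\<Sum>i\<in>A. ell2_nth (\<Lambda> (f i)) i) =
      cmod ((\<Sum>i\<in>A. ell2_nth (\<Lambda> (U i)) i) + \<i> * (\<Sum>i\<in>A. ell2_nth (\<Lambda> (V i)) i))"
    by (simp add: split sum.distrib sum_distrib_left)
  also have "\<dots> \<le> cmod (\<Sum>i\<in>A. ell2_nth (\<Lambda> (U i)) i) + cmod (\<Sum>i\<in>A. ell2_nth (\<Lambda> (V i)) i)"
    by (rule norm_triangle_le) (simp add: norm_mult)
  also have "\<dots> \<le> K * exp (1 / 2) * sqrt (card A) + K * exp (1 / 2) * sqrt (card A)"
  proof (intro add_mono trace_through_linfty_le_real[OF assms(1) bound K \<open>finite A\<close>])
    fix k
    show "(\<Sum>i\<in>A. (Re (apply_bcontfun (f i) k))\<^sup>2) \<le> 1"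
      by (rule order_trans[OF sum_mono f[of k]]) (simp add: cmod_power2)
    show "(\<Sum>i\<in>A. (Im (apply_bcontfun (f i) k))\<^sup>2) \<le> 1"
      by (rule order_trans[OF sum_mono f[of k]]) (simp add: cmod_power2)
  qed (simp_all add: U_apply V_apply)
  finally show ?thesis
    by (simp add: algebra_simps)
qed

section \<open>Orbits of a bounded semigroup\<close>

text \<open>The generator gives only the right derivative at 0. The difference quotient at \<open>s\<close> is
  \<open>S (min s u)\<close> applied to a difference quotient at 0, and uniform boundedness of the semigroup
  carries the convergence over, also from the left, where \<open>S u y\<close> has to be compared with
  \<open>S s y\<close>.\<close>

lemma C0_semigroup_orbit_has_vector_derivative:
  assumes S: "C0_semigroup S" and M: "\<And>t x. 0 \<le> t \<Longrightarrow> norm (S t x) \<le> M * norm x"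
    and "0 \<le> M" and y: "((\<lambda>t. (S t x - x) /\<^sub>R t) \<longlongrightarrow> y) (at_right 0)"
    and s: "0 \<le> s"
  shows "((\<lambda>t. S t x) has_vector_derivative S s y) (at s within {0..})"
proof -
  have lin: "linear (S t)" if "0 \<le> t" for t
    using S that by (auto simp: C0_semigroup_def bounded_clinear_def intro: bounded_linear.linear)
  have add: "S (u + d) v = S u (S d v)" if "0 \<le> u" "0 \<le> d" for u d v
    using S that by (simp add: C0_semigroup_def)
  define \<rho> where "\<rho> d = norm ((S d x - x) /\<^sub>R d - y) + norm (S d y - y)" for d
  have "(\<rho> \<longlongrightarrow> norm (y - y) + norm (y - y)) (at_right 0)"
    unfolding \<rho>_def using S by (intro tendsto_intros y) (auto simp: C0_semigroup_def)
  then have \<rho>: "(\<rho> \<longlongrightarrow> 0) (at_right 0)"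
    by simp
  have quotient: "norm ((S u x - S s x) /\<^sub>R (u - s) - S s y) \<le> M * \<rho> \<bar>u - s\<bar>"
    if u: "0 \<le> u" "u \<noteq> s" for u
  proof (cases "s < u")
    case True
    define d where "d = u - s"
    have d: "0 < d" "u = s + d"
      using True by (auto simp: d_def)
    have "(S u x - S s x) /\<^sub>R (u - s) - S s y = S s ((S d x - x) /\<^sub>R d - y)"
      using d s by (simp add: add linear_diff[OF lin] linear_scale[OF lin])
    also have "norm \<dots> \<le> M * norm ((S d x - x) /\<^sub>R d - y)"
      by (rule M[OF s])
    also have "\<dots> \<le> M * \<rho> d"
      using \<open>0 \<le> M\<close> by (simp add: \<rho>_def distrib_left)
    finally show ?thesis
      using d by simp
  next
    case False
    define d where "d = s - u"
    have d: "0 < d" "s = u + d"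
      using False u by (auto simp: d_def)
    have "(S u x - S s x) /\<^sub>R (u - s) - S s y = S u ((S d x - x) /\<^sub>R d - y) - S u (S d y - y)"
    proof -
      have "S s v = S u (S d v)" for v
        using d u by (simp add: add)
      moreover have "(S u x - S s x) /\<^sub>R (u - s) = (S s x - S u x) /\<^sub>R d"
        using d by (simp add: scaleR_diff_right)
      ultimately show ?thesis
        using d u by (simp add: linear_diff[OF lin] linear_scale[OF lin])
    qed
    also have "norm \<dots> \<le> M * norm ((S d x - x) /\<^sub>R d - y) + M * norm (S d y - y)"
      by (intro order_trans[OF norm_triangle_ineq4] add_mono M u)
    also have "\<dots> = M * \<rho> d"
      by (simp add: \<rho>_def distrib_left)
    finally show ?thesis
      using d by simp
  qed
  have "((\<lambda>u. norm ((S u x - S s x) - (u - s) *\<^sub>R S s y) / norm (u - s)) \<longlongrightarrow> 0)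
      (at s within {0..})"
  proof (rule Lim_null_comparison)
    have "norm ((S u x - S s x) - (u - s) *\<^sub>R S s y) / norm (u - s) \<le> M * \<rho> \<bar>u - s\<bar>"
      if u: "0 \<le> u" "u \<noteq> s" for u
    proof -
      have "(S u x - S s x) - (u - s) *\<^sub>R S s y =
          (u - s) *\<^sub>R ((S u x - S s x) /\<^sub>R (u - s) - S s y)"
        using u by (simp add: scaleR_diff_right)
      then show ?thesis
        using quotient[OF u] u by simp
    qed
    then show "\<forall>\<^sub>F u in at s within {0..}.
        norm (norm ((S u x - S s x) - (u - s) *\<^sub>R S s y) / norm (u - s)) \<le> M * \<rho> \<bar>u - s\<bar>"
      by (auto simp: eventually_at intro!: exI[of _ 1])
    have "((\<lambda>u. \<bar>u - s\<bar>) \<longlongrightarrow> \<bar>s - s\<bar>) (at s within {0..})"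
      by (intro tendsto_intros)
    then have "filterlim (\<lambda>u. \<bar>u - s\<bar>) (at_right 0) (at s within {0..})"
      by (auto simp: filterlim_at eventually_at intro!: exI[of _ 1])
    from tendsto_mult_right_zero[OF filterlim_compose[OF \<rho> this]]
    show "((\<lambda>u. M * \<rho> \<bar>u - s\<bar>) \<longlongrightarrow> 0) (at s within {0..})" .
  qed
  then show ?thesis
    by (simp add: has_vector_derivative_def has_derivative_iff_norm bounded_linear_scaleR_left)
qed

section \<open>The identity semigroup with output \<open>coefficient_map z\<close>\<close>

text \<open>Any time \<open>t\<close> with \<open>M exp (- \<mu> t) \<le> 1 / 2\<close> serves for all \<open>n\<close>: the trace of the
  \<open>n \<times> n\<close> corner of \<open>S\<close> has to drop from \<open>n\<close> to at most \<open>n / 2\<close> during \<open>[0, t]\<close>, while its speed is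
  at most a multiple of \<open>sqrt n\<close>.\<close>

lemma not_exp_detectable_coefficient_map:
  assumes z_sphere: "range z \<subseteq> sphere 0 1"
  shows "\<not> exp_detectable UNIV (\<lambda>x. 0) (coefficient_map z)"
proof
  define C where "C = coefficient_map z"
  have C: "bounded_clinear C"
    unfolding C_def by (rule bounded_clinear_coefficient_map[OF z_sphere])
  assume "exp_detectable UNIV (\<lambda>x. 0) (coefficient_map z)"
  then obtain L S where L: "bounded_clinear L" and gen: "generates UNIV (\<lambda>x. L (C x)) S"
    and stable: "uniformly_exp_stable S"
    by (auto simp: exp_detectable_def C_def)
  have S: "C0_semigroup S"
    and y: "((\<lambda>t. (S t x - x) /\<^sub>R t) \<longlongrightarrow> L (C x)) (at_right 0)" for x
    using gen by (auto simp: generates_def)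
  obtain M \<mu> where "0 < M" "0 < \<mu>"
    and decay: "\<And>x t. 0 \<le> t \<Longrightarrow> norm (S t x) \<le> M * exp (- \<mu> * t) * norm x"
    using stable unfolding uniformly_exp_stable_def by blast
  have M: "norm (S t x) \<le> M * norm x" if "0 \<le> t" for t x
  proof -
    have "M * exp (- \<mu> * t) * norm x \<le> M * 1 * norm x"
      using \<open>0 < M\<close> \<open>0 < \<mu>\<close> that by (intro mult_right_mono mult_left_mono) auto
    then show ?thesis
      using decay[OF that, of x] by simp
  qed
  obtain l where "0 < l" and l: "\<And>g. norm (L g) \<le> l * norm g"
    using L bounded_linear.pos_bounded[of L] by (auto simp: bounded_clinear_def mult.commute)
  \<comment> \<open>\<open>2 * M\<close> would suffice for \<open>half\<close>; adding 1 makes \<open>t\<close> positive.\<close>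
  define t where "t = ln (2 * M + 1) / \<mu>"
  have "0 < t"
    using \<open>0 < M\<close> \<open>0 < \<mu>\<close> by (simp add: t_def)
  have half: "M * exp (- \<mu> * t) \<le> 1 / 2"
    using \<open>0 < M\<close> \<open>0 < \<mu>\<close> by (simp add: t_def exp_minus field_simps)
  define K where "K = 2 * (M * l) * exp (1 / 2)"
  have "real n \<le> 2 * t * K * sqrt n" for n
  proof -
    define h where "h s = (\<Sum>i<n. ell2_nth (S s (unit_ell2 i)) i)" for s
    define h' where "h' s = (\<Sum>i<n. ell2_nth (S s (L (C (unit_ell2 i)))) i)" for s
    have h0: "h 0 = n"
      using S by (simp add: h_def C0_semigroup_def ell2_nth_unit)
    have ht: "cmod (h t) \<le> n / 2"
    proof -
      have "cmod (h t) \<le> (\<Sum>i<n. 1 / 2)"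
        unfolding h_def
      proof (rule sum_norm_le)
        fix i
        show "cmod (ell2_nth (S t (unit_ell2 i)) i) \<le> 1 / 2"
          using cmod_ell2_nth_le[of "S t (unit_ell2 i)" i] decay[of t "unit_ell2 i"] \<open>0 < t\<close> half
          by (simp add: norm_unit_ell2)
      qed
      then show ?thesis
        by simp
    qed
    have deriv: "(h has_vector_derivative h' s) (at s within {0..t})" if "s \<in> {0..t}" for s
    proof -
      have "((\<lambda>s. ell2_nth (S s (unit_ell2 i)) i) has_vector_derivative
          ell2_nth (S s (L (C (unit_ell2 i)))) i) (at s within {0..t})" for i
        by (rule bounded_linear.has_vector_derivative[OF bounded_linear_ell2_nth],
            rule has_vector_derivative_within_subset,
            rule C0_semigroup_orbit_has_vector_derivative[OF S M _ y]) (use that \<open>0 < M\<close> in auto)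
      then show ?thesis
        unfolding h_def[abs_def] h'_def by (intro has_vector_derivative_sum) auto
    qed
    have bound: "cmod (h' s) \<le> K * sqrt n" if "s \<in> {0..t}" for s
    proof -
      have "0 \<le> s"
        using that by simp
      then have Ss: "bounded_clinear (S s)"
        using S by (simp add: C0_semigroup_def)
      have "cmod (\<Sum>i<n. ell2_nth (S s (L (C (unit_ell2 i)))) i)
          \<le> 2 * (M * l) * exp (1 / 2) * sqrt (card {..<n})"
      proof (rule trace_through_linfty_le)
        show "bounded_clinear (\<lambda>g. S s (L g))"
          using Ss L by (auto simp: bounded_clinear_def intro: bounded_linear_compose)
        show "norm (S s (L g)) \<le> M * l * norm g" for g
          using \<open>0 < M\<close>
          by (auto intro!: order_trans[OF M[OF \<open>0 \<le> s\<close>]] mult_left_mono l simp: mult.assoc)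
        \<comment> \<open>The \<open>k\<close>-th entry of \<open>C e\<^sub>i\<close> is the conjugate of the \<open>i\<close>-th entry of \<open>z k\<close>.\<close>
        show "(\<Sum>i<n. (cmod (apply_bcontfun (C (unit_ell2 i)) k))\<^sup>2) \<le> 1" for k
        proof -
          have "norm (z k) = 1"
            using z_sphere by (auto simp: image_subset_iff)
          then show ?thesis
            using sum_cmod_ell2_nth_le[of "{..<n}" "z k"]
            by (simp add: C_def apply_coefficient_map[OF z_sphere] cinner_unit_ell2)
        qed
      qed (use \<open>0 < M\<close> \<open>0 < l\<close> in auto)
      then show ?thesis
        by (simp add: h'_def K_def)
    qed
    have "cmod (h t - h 0) \<le> K * sqrt n * norm (t - 0)"
    proof (rule differentiable_bound[of "{0..t}"])
      show "(h has_derivative (\<lambda>r. r *\<^sub>R h' s)) (at s within {0..t})" if "s \<in> {0..t}" for s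
        using deriv[OF that] by (simp add: has_vector_derivative_def)
      show "onorm (\<lambda>r. r *\<^sub>R h' s) \<le> K * sqrt n" if "s \<in> {0..t}" for s
        by (rule onorm_le) (use bound[OF that] in \<open>simp add: mult.commute mult_left_mono\<close>)
    qed (use \<open>0 < t\<close> in auto)
    moreover have "real n - n / 2 \<le> cmod (h t - h 0)"
      using norm_triangle_ineq2[of "h 0" "h t"] ht by (simp add: h0 norm_minus_commute)
    ultimately show ?thesis
      using \<open>0 < t\<close> by (simp add: mult_ac)
  qed
  then have sqrt_le: "sqrt n \<le> 2 * t * K" if "0 < n" for n :: nat
  proof -
    have "sqrt n * sqrt n \<le> 2 * t * K * sqrt n"
      using \<open>real n \<le> 2 * t * K * sqrt n\<close> by simp
    then show ?thesis
      by (rule mult_right_le_imp_le) (use that in simp)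
  qed
  obtain n :: nat where n: "(2 * t * K)\<^sup>2 < n"
    using reals_Archimedean2 by blast
  then have "0 < n"
    by (metis not_gr_zero not_less of_nat_0 zero_le_power2)
  from real_less_rsqrt[OF n] sqrt_le[OF this] show False
    by simp
qed

lemma coercive_eOSS_Lyapunov_norm:
  fixes C :: "'a::complex_normed_vector \<Rightarrow> 'b::complex_normed_vector"
  assumes "\<And>x. norm (C x) = norm x"
  shows "coercive_eOSS_Lyapunov_dissipation (\<lambda>t x. x) C norm 1 (\<lambda>r. r)"
proof -
  have "\<not> bdd_above ((\<lambda>r. r) ` {0::real..})"
  proof
    assume "bdd_above ((\<lambda>r. r) ` {0::real..})"
    then obtain b :: real where b: "\<And>r. 0 \<le> r \<Longrightarrow> r \<le> b"
      by (auto simp: bdd_above_def)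
    show False
      using b[of 0] b[of "b + 1"] by simp
  qed
  then have "(\<lambda>r. r) \<in> K_infinity"
    by (auto simp: K_infinity_def strict_mono_on_def)
  moreover have "lie_derivative (\<lambda>t x. x) norm x = 0" for x :: 'a
    by (simp add: lie_derivative_def Limsup_const zero_ereal_def[symmetric])
  ultimately show ?thesis
    unfolding coercive_eOSS_Lyapunov_dissipation_def
    by (auto intro!: exI[of _ 1] simp: assms)
qed

theorem proposition5p3:
  fixes z :: "nat \<Rightarrow> ell2"
    and C :: "ell2 \<Rightarrow> linfty"
    and A :: "ell2 \<Rightarrow> ell2"
    and T :: "real \<Rightarrow> ell2 \<Rightarrow> ell2"
  assumes z_sphere: "range z \<subseteq> sphere 0 1"
    and z_dense: "sphere 0 1 \<subseteq> closure (range z)"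
    and C: "C = coefficient_map z"
    and A: "A = (\<lambda>x. 0)"
    and T: "T = (\<lambda>t x. x)"
  shows "bounded_clinear C \<and> (\<forall>x. norm (C x) = norm x) \<and>
    (\<exists>V \<sigma>. coercive_eOSS_Lyapunov_dissipation T C V 1 \<sigma> \<and> linear_gain \<sigma>) \<and>
    \<not> exp_detectable UNIV A C \<and>
    (\<forall>\<tau>>0. \<exists>c>0. \<forall>x.
      (LINT t:{0..\<tau>}|lborel. (norm (C (T t x)))\<^sup>2) \<ge> c * (norm x)\<^sup>2)"
proof (intro conjI allI impI)
  note isometry = norm_coefficient_map[OF z_sphere z_dense]
  show "bounded_clinear C"
    unfolding C by (rule bounded_clinear_coefficient_map[OF z_sphere])
  show "norm (C x) = norm x" for x
    unfolding C by (rule isometry)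
  have "coercive_eOSS_Lyapunov_dissipation T C norm 1 (\<lambda>r. r)"
    unfolding T C by (rule coercive_eOSS_Lyapunov_norm[OF isometry])
  moreover have "linear_gain (\<lambda>r. r)"
    by (auto simp: linear_gain_def intro: exI[of _ 1])
  ultimately show "\<exists>V \<sigma>. coercive_eOSS_Lyapunov_dissipation T C V 1 \<sigma> \<and> linear_gain \<sigma>"
    by blast
  show "\<not> exp_detectable UNIV A C"
    unfolding A C by (rule not_exp_detectable_coefficient_map[OF z_sphere])
  show "\<exists>c>0. \<forall>x. (LINT t:{0..\<tau>}|lborel. (norm (C (T t x)))\<^sup>2) \<ge> c * (norm x)\<^sup>2"
    if "0 < \<tau>" for \<tau>
    by (rule exI[of _ \<tau>]) (use that in \<open>simp add: T C isometry set_lebesgue_integral_def\<close>)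
qed

end
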